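(* Let $t\ge 1$ be an integer and $d=2^t$. Then in the three-partite system $\mathbb{C}^d\otimes\mathbb{C}^d\otimes\mathbb{C}^d$ there exists a set of $d+3$ (mutually orthogonal) $t$-level lattice-type GHZ states that is genuinely nonlocal.
   Context: Three-qubit GHZ basis of $\mathbb{C}^2\otimes\mathbb{C}^2\otimes\mathbb{C}^2$ (parties $A,B,C$ in this order): $|\psi_{0}\rangle,|\psi_7\rangle=\frac{|000\rangle\pm|111\rangle}{\sqrt2}$, $|\psi_{1}\rangle,|\psi_6\rangle=\frac{|001\rangle\pm|110\rangle}{\sqrt2}$, $|\psi_{2}\rangle,|\psi_5\rangle=\frac{|010\rangle\pm|101\rangle}{\sqrt2}$, $|\psi_{3}\rangle,|\psi_4\rangle=\frac{|011\rangle\pm|100\rangle}{\sqrt2}$, where in each pair the first-named state has sign $+$ and the second has sign $-$. Lattice-type GHZ states (GHZ-lattices): for $\vec v=(v_1,\dots,v_t)\in\{0,\dots,7\}^t$, the $t$-level lattice-type GHZ state with index $\vec v$ is $|\Psi_{\vec v}\rangle=|\psi_{v_1}\rangle\otimes\cdots\otimes|\psi_{v_t}\rangle$, regarded as a state of the three-partite system $\mathbb{C}^{2^t}\otimes\mathbb{C}^{2^t}\otimes\mathbb{C}^{2^t}$ in which party $A$ (resp. $B$, $C$) holds the first (resp. second, third) qubit of each of the $t$ tensor factors. These $8^t$ states form an orthonormal basis. Local distinguishability: a set of orthogonal pure states, known in advance to the parties, is locally distinguishable if, when the parties share an unknown state from the set, they can determine with certainty which state it is by a protocol using only local operations (measurements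 on their own subsystems) and classical communication (LOCC). Otherwise it is locally indistinguishable. Genuine nonlocality: a set of orthogonal states in a three-partite system with parties $A,B,C$ is (distinguishability-based) genuinely nonlocal if it is locally indistinguishable across each of the bipartitions $A|BC$, $B|CA$, $C|AB$ (in a bipartition the two grouped parties act jointly as a single party). *)

theory Defs
  imports "Jordan_Normal_Form.Schur_Decomposition"
begin

text \<open>
  Tensor products are encoded with the first factor as the most significant part of the index:
  the basis vector \<open>|i\<rangle>|j\<rangle>\<close> of \<open>\<complex>\<^sup>m \<otimes> \<complex>\<^sup>n\<close> has index \<open>i * n + j\<close>. Hence a vector of
  \<open>\<complex>\<^sup>a \<otimes> \<complex>\<^sup>b \<otimes> \<complex>\<^sup>c\<close> is literally a vector of \<open>\<complex>\<^sup>a \<otimes> \<complex>\<^bsup>b * c\<^esup>\<close>.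
\<close>

definition kronecker :: "complex mat \<Rightarrow> complex mat \<Rightarrow> complex mat" where
  "kronecker A B = mat (dim_row A * dim_row B) (dim_col A * dim_col B)
     (\<lambda>(i, j). A $$ (i div dim_row B, j div dim_col B) * B $$ (i mod dim_row B, j mod dim_col B))"


section \<open>Bipartite LOCC protocols\<close>

text \<open>
  In \<open>Measure_First r K P\<close> the first party performs the measurement with Kraus operators
  \<open>K 0, \<dots>, K (r - 1)\<close>, announces the outcome \<open>i\<close>, and both parties go on with \<open>P i\<close>; values of
  \<open>K\<close> and \<open>P\<close> at arguments \<open>\<ge> r\<close> are irrelevant. Every outcome leads to a well-founded
  continuation and only finitely many outcomes are possible, so these are exactly the protocols
  with finitely many rounds. A Kraus operator may change the dimension of the local space, which
  covers local ancillas, discarding subsystems and local randomness. Instruments with several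
  Kraus operators per outcome are obtained by ignoring part of the outcome in \<open>P\<close>.
\<close>

datatype 'l protocol =
    Decide 'l
  | Measure_First nat "nat \<Rightarrow> complex mat" "nat \<Rightarrow> 'l protocol"
  | Measure_Second nat "nat \<Rightarrow> complex mat" "nat \<Rightarrow> 'l protocol"

definition measurement :: "nat \<Rightarrow> nat \<Rightarrow> (nat \<Rightarrow> complex mat) \<Rightarrow> bool" where
  "measurement m r K \<longleftrightarrow>
     (\<forall>i<r. dim_col (K i) = m) \<and>
     mat m m (\<lambda>jk. \<Sum>i<r. (mat_adjoint (K i) * K i) $$ jk) = 1\<^sub>m m"

primrec valid_protocol :: "'l protocol \<Rightarrow> nat \<Rightarrow> nat \<Rightarrow> bool" where
  "valid_protocol (Decide x) m n \<longleftrightarrow> True"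
| "valid_protocol (Measure_First r K P) m n \<longleftrightarrow>
     measurement m r K \<and> (\<forall>i<r. valid_protocol (P i) (dim_row (K i)) n)"
| "valid_protocol (Measure_Second r K P) m n \<longleftrightarrow>
     measurement n r K \<and> (\<forall>i<r. valid_protocol (P i) m (dim_row (K i)))"

text \<open>
  \<open>prob_decide P m n \<psi> l\<close> is the probability that \<open>P\<close>, run on \<open>\<psi> \<in> \<complex>\<^sup>m \<otimes> \<complex>\<^sup>n\<close>, ends with the
  decision \<open>l\<close>. Post-measurement states are not renormalised, so the squared norm at a leaf is
  the probability of the whole branch.
\<close>

primrec prob_decide :: "'l protocol \<Rightarrow> nat \<Rightarrow> nat \<Rightarrow> complex vec \<Rightarrow> 'l \<Rightarrow> real" where
  "prob_decide (Decide x) m n \<psi> l = (if x = l then Re (\<psi> \<bullet>c \<psi>) else 0)"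
| "prob_decide (Measure_First r K P) m n \<psi> l =
     (\<Sum>i<r. prob_decide (P i) (dim_row (K i)) n (kronecker (K i) (1\<^sub>m n) *\<^sub>v \<psi>) l)"
| "prob_decide (Measure_Second r K P) m n \<psi> l =
     (\<Sum>i<r. prob_decide (P i) m (dim_row (K i)) (kronecker (1\<^sub>m m) (K i) *\<^sub>v \<psi>) l)"

definition locally_distinguishable :: "nat \<Rightarrow> nat \<Rightarrow> complex vec set \<Rightarrow> bool" where
  "locally_distinguishable m n S \<longleftrightarrow>
     (\<exists>P :: complex vec protocol. valid_protocol P m n \<and> (\<forall>\<psi>\<in>S. prob_decide P m n \<psi> \<psi> = 1))"


section \<open>Genuine nonlocality\<close>

definition orthonormal_states :: "nat \<Rightarrow> complex vec set \<Rightarrow> bool" where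
  "orthonormal_states n S \<longleftrightarrow>
     S \<subseteq> carrier_vec n \<and> (\<forall>\<psi>\<in>S. \<psi> \<bullet>c \<psi> = 1) \<and> pairwise (\<lambda>\<phi> \<psi>. \<phi> \<bullet>c \<psi> = 0) S"

text \<open>The vector whose amplitude at \<open>|a\<rangle>|b\<rangle>|c\<rangle>\<close> is \<open>f a b c\<close>:\<close>

definition tripartite_vec ::
  "nat \<Rightarrow> nat \<Rightarrow> nat \<Rightarrow> (nat \<Rightarrow> nat \<Rightarrow> nat \<Rightarrow> complex) \<Rightarrow> complex vec" where
  "tripartite_vec dA dB dC f =
     vec (dA * dB * dC) (\<lambda>i. f (i div (dB * dC)) (i div dC mod dB) (i mod dC))"

text \<open>Reordering of the parties from \<open>A, B, C\<close> to \<open>B, C, A\<close>:\<close>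

definition cycle_parties :: "nat \<Rightarrow> nat \<Rightarrow> nat \<Rightarrow> complex vec \<Rightarrow> complex vec" where
  "cycle_parties dA dB dC \<psi> =
     tripartite_vec dB dC dA (\<lambda>b c a. \<psi> $ ((a * dB + b) * dC + c))"

text \<open>The three conditions refer to the bipartitions \<open>A|BC\<close>, \<open>B|CA\<close> and \<open>C|AB\<close>, in this order.\<close>

definition genuinely_nonlocal :: "nat \<Rightarrow> nat \<Rightarrow> nat \<Rightarrow> complex vec set \<Rightarrow> bool" where
  "genuinely_nonlocal dA dB dC S \<longleftrightarrow>
     orthonormal_states (dA * dB * dC) S \<and>
     \<not> locally_distinguishable dA (dB * dC) S \<and>
     \<not> locally_distinguishable dB (dC * dA) (cycle_parties dA dB dC ` S) \<and>
     \<not> locally_distinguishable dC (dA * dB)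
         (cycle_parties dB dC dA ` cycle_parties dA dB dC ` S)"


section \<open>Lattice-type GHZ states\<close>

definition ket3 :: "nat \<Rightarrow> nat \<Rightarrow> nat \<Rightarrow> complex vec" where
  "ket3 a b c = unit_vec 8 (4 * a + 2 * b + c)"

definition ghz :: "nat \<Rightarrow> complex vec" where
  "ghz v = complex_of_real (1 / sqrt 2) \<cdot>\<^sub>v
     [ket3 0 0 0 + ket3 1 1 1,
      ket3 0 0 1 + ket3 1 1 0,
      ket3 0 1 0 + ket3 1 0 1,
      ket3 0 1 1 + ket3 1 0 0,
      ket3 0 1 1 - ket3 1 0 0,
      ket3 0 1 0 - ket3 1 0 1,
      ket3 0 0 1 - ket3 1 1 0,
      ket3 0 0 0 - ket3 1 1 1] ! v"

text \<open>
  A basis index \<open>a < 2 ^ t\<close> of one party stands for its \<open>t\<close> qubits, the qubit of the first tensor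
  factor being the most significant bit. The amplitude of \<open>|\<psi>\<^bsub>v\<^esub>\<rangle> \<otimes> \<dots>\<close> at \<open>|a\<rangle>|b\<rangle>|c\<rangle>\<close> is the
  product over the levels \<open>k\<close> of the amplitudes at the \<open>k\<close>-th qubits of the three parties.
\<close>

definition qubit :: "nat \<Rightarrow> nat \<Rightarrow> nat \<Rightarrow> nat" where
  "qubit t a k = a div 2 ^ (t - 1 - k) mod 2"

definition lattice_ghz :: "nat list \<Rightarrow> complex vec" where
  "lattice_ghz v = (let t = length v; d = 2 ^ t in
     tripartite_vec d d d
       (\<lambda>a b c. \<Prod>k<t. ghz (v ! k) $ (4 * qubit t a k + 2 * qubit t b k + qubit t c k)))"

definition lattice_ghz_states :: "nat \<Rightarrow> complex vec set" where
  "lattice_ghz_states t = lattice_ghz ` {v. length v = t \<and> set v \<subseteq> {0..7}}"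

end

theory Submission
  imports Defs "HOL-Analysis.L2_Norm"
begin

text \<open>
  The witness consists of the \<open>d\<close> states with indices in \<open>{0, 7}\<^sup>t\<close> and the three states with
  constant index \<open>1\<close>, \<open>2\<close>, \<open>3\<close>. Cycling the parties permutes these states, so it suffices to
  consider \<open>A|BC\<close>. There the states with indices in \<open>{0, 7}\<^sup>t\<close> and the one with index \<open>(3, \<dots>, 3)\<close>
  are \<open>d + 1\<close> maximally entangled states on \<open>A\<close> and the span of the \<open>d\<close> vectors \<open>|b\<rangle>|b\<rangle>\<close> of \<open>BC\<close>. The
  probability of a decision on such a state is at most \<open>1 / d\<close> times the sum of its probabilities
  on the \<open>d\<^sup>2\<close> product basis states, so at most \<open>d\<close> such states can be distinguished.
\<close>

section \<open>Protocols on sums of product vectors\<close>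

text \<open>A state is carried as two families of local vectors rather than as one amplitude vector,
  so that an operator of one party changes only the family of that party.\<close>

definition tensor_sum ::
  "nat \<Rightarrow> nat \<Rightarrow> 'i set \<Rightarrow> ('i \<Rightarrow> complex vec) \<Rightarrow> ('i \<Rightarrow> complex vec) \<Rightarrow> complex vec" where
  "tensor_sum m n I a b = vec (m * n) (\<lambda>x. \<Sum>i\<in>I. a i $ (x div n) * b i $ (x mod n))"

text \<open>Product vectors are the one-term case, so every fact about \<open>tensor_sum\<close>
  covers them.\<close>

abbreviation tensor :: "nat \<Rightarrow> nat \<Rightarrow> complex vec \<Rightarrow> complex vec \<Rightarrow> complex vec" where
  "tensor m n u w \<equiv> tensor_sum m n {()} (\<lambda>_. u) (\<lambda>_. w)"

section \<open>Norms, index arithmetic and Cauchy-Schwarz for finite sums\<close>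

lemma inner_self_eq: "v \<bullet>c v = complex_of_real (\<Sum>i<dim_vec v. (cmod (v $ i))\<^sup>2)"
  by (simp add: scalar_prod_def complex_norm_square lessThan_atLeast0 del: of_real_power)

lemma mod_less_mult: "i < m * n \<Longrightarrow> i mod n < (n :: nat)"
  by (cases "n = 0") auto

lemma div_less_mult: "i < m * n \<Longrightarrow> i div n < (m :: nat)"
  by (simp add: less_mult_imp_div_less)

lemma add_mult_less:
  assumes "x < m" and "y < n"
  shows "y + x * n < m * (n :: nat)"
proof -
  have "y + x * n < Suc x * n" using assms(2) by simp
  also have "\<dots> \<le> m * n" using assms(1) by (intro mult_right_mono) auto
  finally show ?thesis .
qed

lemma sum_lessThan_mult:
  fixes f :: "nat \<Rightarrow> 'a :: comm_monoid_add"
  shows "sum f {..<m * n} = (\<Sum>x<m. \<Sum>y<n. f (y + x * n))"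
proof -
  have "sum f {x * n..<x * n + n} = (\<Sum>y<n. f (y + x * n))" for x
    using sum.shift_bounds_nat_ivl[of f 0 "x * n" n] by (simp add: add.commute lessThan_atLeast0)
  then show ?thesis
    using sum.nat_group[of f n m] by simp
qed

lemma sum_mult_squared_le:
  fixes f g :: "'i \<Rightarrow> real"
  shows "(\<Sum>i\<in>I. f i * g i)\<^sup>2 \<le> (\<Sum>i\<in>I. (f i)\<^sup>2) * (\<Sum>i\<in>I. (g i)\<^sup>2)"
proof -
  have "\<bar>\<Sum>i\<in>I. f i * g i\<bar> \<le> L2_set f I * L2_set g I"
    using L2_set_mult_ineq[of f g I] sum_abs[of "\<lambda>i. f i * g i" I] by (simp add: abs_mult)
  then have "(\<Sum>i\<in>I. f i * g i)\<^sup>2 \<le> (L2_set f I * L2_set g I)\<^sup>2"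
    by (metis abs_ge_zero power2_abs power_mono)
  then show ?thesis
    by (simp add: L2_set_def power_mult_distrib sum_nonneg)
qed

section \<open>Local operators on sums of product vectors\<close>

lemma kronecker_first_tensor_sum:
  assumes "dim_col K = m" and "\<And>i. i \<in> I \<Longrightarrow> a i \<in> carrier_vec m"
  shows "kronecker K (1\<^sub>m n) *\<^sub>v tensor_sum m n I a b =
    tensor_sum (dim_row K) n I (\<lambda>i. K *\<^sub>v a i) b"
proof (rule eq_vecI)
  show "dim_vec (kronecker K (1\<^sub>m n) *\<^sub>v tensor_sum m n I a b) =
      dim_vec (tensor_sum (dim_row K) n I (\<lambda>i. K *\<^sub>v a i) b)"
    by (simp add: kronecker_def tensor_sum_def)
next
  fix r assume "r < dim_vec (tensor_sum (dim_row K) n I (\<lambda>i. K *\<^sub>v a i) b)"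
  then have r: "r < dim_row K * n" by (simp add: tensor_sum_def)
  note rr = div_less_mult[OF r] mod_less_mult[OF r]
  have "(kronecker K (1\<^sub>m n) *\<^sub>v tensor_sum m n I a b) $ r =
      (\<Sum>j<m * n. kronecker K (1\<^sub>m n) $$ (r, j) * tensor_sum m n I a b $ j)"
    using r assms by (simp add: kronecker_def tensor_sum_def scalar_prod_def lessThan_atLeast0)
  \<comment> \<open>With \<open>j = y + x * n\<close>, the identity factor keeps only the columns
    with \<open>y = r mod n\<close>.\<close>
  also have "\<dots> = (\<Sum>x<m. \<Sum>y<n. (if r mod n = y then
      K $$ (r div n, x) * (\<Sum>i\<in>I. a i $ x * b i $ y) else 0))"
    unfolding sum_lessThan_mult
  proof (intro sum.cong refl)
    fix x y assume "x \<in> {..<m}" "y \<in> {..<n}"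
    then have *: "y + x * n < m * n" "(y + x * n) div n = x" "(y + x * n) mod n = y" "y < n"
      by (auto intro: add_mult_less)
    show "kronecker K (1\<^sub>m n) $$ (r, y + x * n) * tensor_sum m n I a b $ (y + x * n) =
      (if r mod n = y then K $$ (r div n, x) * (\<Sum>i\<in>I. a i $ x * b i $ y) else 0)"
      using r rr * assms by (simp add: kronecker_def tensor_sum_def)
  qed
  also have "\<dots> = (\<Sum>x<m. K $$ (r div n, x) * (\<Sum>i\<in>I. a i $ x * b i $ (r mod n)))"
    using rr by simp
  also have "\<dots> = (\<Sum>i\<in>I. (\<Sum>x<m. K $$ (r div n, x) * a i $ x) * b i $ (r mod n))"
    unfolding sum_distrib_left sum_distrib_right by (subst sum.swap) (simp add: mult.assoc)
  also have "\<dots> = (\<Sum>i\<in>I. (K *\<^sub>v a i) $ (r div n) * b i $ (r mod n))"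
  proof (intro sum.cong refl arg_cong2[where f = "(*)"])
    fix i assume "i \<in> I"
    then have "dim_vec (a i) = dim_col K" using assms by auto
    then show "(\<Sum>x<m. K $$ (r div n, x) * a i $ x) = (K *\<^sub>v a i) $ (r div n)"
      using rr assms(1) by (simp add: scalar_prod_def lessThan_atLeast0)
  qed
  finally show "(kronecker K (1\<^sub>m n) *\<^sub>v tensor_sum m n I a b) $ r =
      tensor_sum (dim_row K) n I (\<lambda>i. K *\<^sub>v a i) b $ r"
    using r by (simp add: tensor_sum_def)
qed

lemma kronecker_second_tensor_sum:
  assumes "dim_col K = n" and "\<And>i. i \<in> I \<Longrightarrow> b i \<in> carrier_vec n"
  shows "kronecker (1\<^sub>m m) K *\<^sub>v tensor_sum m n I a b =
    tensor_sum m (dim_row K) I a (\<lambda>i. K *\<^sub>v b i)"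
proof (rule eq_vecI)
  show "dim_vec (kronecker (1\<^sub>m m) K *\<^sub>v tensor_sum m n I a b) =
      dim_vec (tensor_sum m (dim_row K) I a (\<lambda>i. K *\<^sub>v b i))"
    by (simp add: kronecker_def tensor_sum_def)
next
  let ?k = "dim_row K"
  fix r assume "r < dim_vec (tensor_sum m ?k I a (\<lambda>i. K *\<^sub>v b i))"
  then have r: "r < m * ?k" by (simp add: tensor_sum_def)
  note rr = div_less_mult[OF r] mod_less_mult[OF r]
  have "(kronecker (1\<^sub>m m) K *\<^sub>v tensor_sum m n I a b) $ r =
      (\<Sum>j<m * n. kronecker (1\<^sub>m m) K $$ (r, j) * tensor_sum m n I a b $ j)"
    using r assms by (simp add: kronecker_def tensor_sum_def scalar_prod_def lessThan_atLeast0)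
  also have "\<dots> = (\<Sum>x<m. \<Sum>y<n. (if r div ?k = x then
      K $$ (r mod ?k, y) * (\<Sum>i\<in>I. a i $ x * b i $ y) else 0))"
    unfolding sum_lessThan_mult
  proof (intro sum.cong refl)
    fix x y assume "x \<in> {..<m}" "y \<in> {..<n}"
    then have *: "y + x * n < m * n" "(y + x * n) div n = x" "(y + x * n) mod n = y" "x < m"
      by (auto intro: add_mult_less)
    show "kronecker (1\<^sub>m m) K $$ (r, y + x * n) * tensor_sum m n I a b $ (y + x * n) =
      (if r div ?k = x then K $$ (r mod ?k, y) * (\<Sum>i\<in>I. a i $ x * b i $ y) else 0)"
      using r rr * assms by (simp add: kronecker_def tensor_sum_def)
  qed
  also have "\<dots> = (\<Sum>y<n. K $$ (r mod ?k, y) * (\<Sum>i\<in>I. a i $ (r div ?k) * b i $ y))"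
    using rr by (subst sum.swap) simp
  also have "\<dots> = (\<Sum>i\<in>I. a i $ (r div ?k) * (\<Sum>y<n. K $$ (r mod ?k, y) * b i $ y))"
    unfolding sum_distrib_left by (subst sum.swap) (simp add: mult_ac)
  also have "\<dots> = (\<Sum>i\<in>I. a i $ (r div ?k) * (K *\<^sub>v b i) $ (r mod ?k))"
  proof (intro sum.cong refl arg_cong2[where f = "(*)"])
    fix i assume "i \<in> I"
    then have "dim_vec (b i) = dim_col K" using assms by auto
    then show "(\<Sum>y<n. K $$ (r mod ?k, y) * b i $ y) = (K *\<^sub>v b i) $ (r mod ?k)"
      using rr assms(1) by (simp add: scalar_prod_def lessThan_atLeast0)
  qed
  finally show "(kronecker (1\<^sub>m m) K *\<^sub>v tensor_sum m n I a b) $ r =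
      tensor_sum m ?k I a (\<lambda>i. K *\<^sub>v b i) $ r"
    using r by (simp add: tensor_sum_def)
qed

section \<open>Norms and decision probabilities of sums of products\<close>

lemma inner_tensor:
  assumes "u \<in> carrier_vec m" and "w \<in> carrier_vec n"
  shows "Re (tensor m n u w \<bullet>c tensor m n u w) = Re (u \<bullet>c u) * Re (w \<bullet>c w)"
proof -
  have "(\<Sum>i<m * n. (cmod (tensor m n u w $ i))\<^sup>2) =
      (\<Sum>x<m. \<Sum>y<n. (cmod (u $ x))\<^sup>2 * (cmod (w $ y))\<^sup>2)"
    unfolding sum_lessThan_mult
  proof (intro sum.cong refl)
    fix x y assume "x \<in> {..<m}" "y \<in> {..<n}"
    then have "y + x * n < m * n" "(y + x * n) div n = x" "(y + x * n) mod n = y"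
      by (auto intro: add_mult_less)
    then show "(cmod (tensor m n u w $ (y + x * n)))\<^sup>2 = (cmod (u $ x))\<^sup>2 * (cmod (w $ y))\<^sup>2"
      by (simp add: tensor_sum_def norm_mult power_mult_distrib)
  qed
  moreover have "dim_vec (tensor m n u w) = m * n" "dim_vec u = m" "dim_vec w = n"
    using assms by (auto simp: tensor_sum_def)
  ultimately show ?thesis
    by (simp add: inner_self_eq sum_product)
qed

text \<open>Cauchy-Schwarz at each index decouples the two families. Expanding the resulting product
  of two sums pairs every \<open>a i\<close> with every \<open>b j\<close>, which is where the terms
  with \<open>i \<noteq> j\<close> come from.\<close>

lemma inner_tensor_sum_le:
  "Re (tensor_sum m n I a b \<bullet>c tensor_sum m n I a b) \<le>
    (\<Sum>i\<in>I. \<Sum>j\<in>I. Re (tensor m n (a i) (b j) \<bullet>c tensor m n (a i) (b j)))"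
proof -
  have *: "(cmod (tensor_sum m n I a b $ x))\<^sup>2 \<le>
      (\<Sum>i\<in>I. \<Sum>j\<in>I. (cmod (tensor m n (a i) (b j) $ x))\<^sup>2)" if "x < m * n" for x
  proof -
    have "cmod (tensor_sum m n I a b $ x) \<le> (\<Sum>i\<in>I. cmod (a i $ (x div n)) * cmod (b i $ (x mod n)))"
      using that by (simp add: tensor_sum_def flip: norm_mult) (rule norm_sum)
    then have "(cmod (tensor_sum m n I a b $ x))\<^sup>2 \<le>
        (\<Sum>i\<in>I. cmod (a i $ (x div n)) * cmod (b i $ (x mod n)))\<^sup>2"
      by (intro power_mono) auto
    also have "\<dots> \<le> (\<Sum>i\<in>I. (cmod (a i $ (x div n)))\<^sup>2) * (\<Sum>j\<in>I. (cmod (b j $ (x mod n)))\<^sup>2)"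
      by (rule sum_mult_squared_le)
    also have "\<dots> = (\<Sum>i\<in>I. \<Sum>j\<in>I. (cmod (tensor m n (a i) (b j) $ x))\<^sup>2)"
      using that by (simp add: tensor_sum_def sum_product norm_mult power_mult_distrib)
    finally show ?thesis .
  qed
  have "(\<Sum>x<m * n. (cmod (tensor_sum m n I a b $ x))\<^sup>2) \<le>
      (\<Sum>x<m * n. \<Sum>i\<in>I. \<Sum>j\<in>I. (cmod (tensor m n (a i) (b j) $ x))\<^sup>2)"
    using * by (intro sum_mono) auto
  also have "\<dots> = (\<Sum>i\<in>I. \<Sum>j\<in>I. \<Sum>x<m * n. (cmod (tensor m n (a i) (b j) $ x))\<^sup>2)"
    by (subst sum.swap, rule sum.cong[OF refl], rule sum.swap)
  finally show ?thesis
    by (simp add: inner_self_eq) (simp add: tensor_sum_def)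
qed

text \<open>
  At a leaf this is the Cauchy-Schwarz inequality, and a measurement operator of either party
  acts on both sides termwise.
\<close>

lemma prob_decide_tensor_sum_le:
  assumes "valid_protocol P m n"
    and "\<And>i. i \<in> I \<Longrightarrow> a i \<in> carrier_vec m" and "\<And>i. i \<in> I \<Longrightarrow> b i \<in> carrier_vec n"
  shows "prob_decide P m n (tensor_sum m n I a b) l \<le>
    (\<Sum>i\<in>I. \<Sum>j\<in>I. prob_decide P m n (tensor m n (a i) (b j)) l)"
  using assms
\<comment> \<open>Dimensions and both families are generalised because Kraus operators change them
  along a branch.\<close>
proof (induction P arbitrary: m n a b)
  case (Decide x)
  show ?case
    using inner_tensor_sum_le[of m n I a b] by simp
next
  case (Measure_First r K P)
  have K: "dim_col (K k) = m" "valid_protocol (P k) (dim_row (K k)) n" if "k < r" for k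
    using Measure_First.prems(1) that by (auto simp: measurement_def)
  have "prob_decide (Measure_First r K P) m n (tensor_sum m n I a b) l =
      (\<Sum>k<r. prob_decide (P k) (dim_row (K k)) n
        (tensor_sum (dim_row (K k)) n I (\<lambda>i. K k *\<^sub>v a i) b) l)"
    using K Measure_First.prems by (simp add: kronecker_first_tensor_sum)
  also have "\<dots> \<le> (\<Sum>k<r. \<Sum>i\<in>I. \<Sum>j\<in>I. prob_decide (P k) (dim_row (K k)) n
        (tensor (dim_row (K k)) n (K k *\<^sub>v a i) (b j)) l)"
    using K Measure_First.prems
    by (intro sum_mono Measure_First.IH) (auto intro!: mult_mat_vec_carrier)
  also have "\<dots> = (\<Sum>k<r. \<Sum>i\<in>I. \<Sum>j\<in>I. prob_decide (P k) (dim_row (K k)) n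
        (kronecker (K k) (1\<^sub>m n) *\<^sub>v tensor m n (a i) (b j)) l)"
    using K Measure_First.prems by (simp add: kronecker_first_tensor_sum)
  also have "\<dots> = (\<Sum>i\<in>I. \<Sum>j\<in>I. prob_decide (Measure_First r K P) m n (tensor m n (a i) (b j)) l)"
    by simp (subst sum.swap, rule sum.cong[OF refl], rule sum.swap)
  finally show ?case .
next
  case (Measure_Second r K P)
  have K: "dim_col (K k) = n" "valid_protocol (P k) m (dim_row (K k))" if "k < r" for k
    using Measure_Second.prems(1) that by (auto simp: measurement_def)
  have "prob_decide (Measure_Second r K P) m n (tensor_sum m n I a b) l =
      (\<Sum>k<r. prob_decide (P k) m (dim_row (K k))
        (tensor_sum m (dim_row (K k)) I a (\<lambda>i. K k *\<^sub>v b i)) l)"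
    using K Measure_Second.prems by (simp add: kronecker_second_tensor_sum)
  also have "\<dots> \<le> (\<Sum>k<r. \<Sum>i\<in>I. \<Sum>j\<in>I. prob_decide (P k) m (dim_row (K k))
        (tensor m (dim_row (K k)) (a i) (K k *\<^sub>v b j)) l)"
    using K Measure_Second.prems
    by (intro sum_mono Measure_Second.IH) (auto intro!: mult_mat_vec_carrier)
  also have "\<dots> = (\<Sum>k<r. \<Sum>i\<in>I. \<Sum>j\<in>I. prob_decide (P k) m (dim_row (K k))
        (kronecker (1\<^sub>m m) (K k) *\<^sub>v tensor m n (a i) (b j)) l)"
    using K Measure_Second.prems by (simp add: kronecker_second_tensor_sum)
  also have "\<dots> = (\<Sum>i\<in>I. \<Sum>j\<in>I. prob_decide (Measure_Second r K P) m n (tensor m n (a i) (b j)) l)"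
    by simp (subst sum.swap, rule sum.cong[OF refl], rule sum.swap)
  finally show ?case .
qed

section \<open>Total probability on product states\<close>

text \<open>Each squared norm is the quadratic form of \<open>mat_adjoint (K k) * K k\<close> at
  \<open>v\<close>, and by completeness these matrices sum to the identity.\<close>

lemma measurement_norm:
  assumes "measurement m r K" and "v \<in> carrier_vec m"
  shows "(\<Sum>k<r. Re ((K k *\<^sub>v v) \<bullet>c (K k *\<^sub>v v))) = Re (v \<bullet>c v)"
proof -
  have dim: "dim_col (K k) = m" if "k < r" for k
    using assms(1) that by (simp add: measurement_def)
  have "(\<Sum>k<r. (K k *\<^sub>v v) \<bullet>c (K k *\<^sub>v v)) =
      (\<Sum>k<r. \<Sum>x<m. \<Sum>y<m. cnj (v $ x) * v $ y * (mat_adjoint (K k) * K k) $$ (x, y))"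
  proof (intro sum.cong refl)
    fix k assume "k \<in> {..<r}"
    then have d: "dim_col (K k) = m" using dim by simp
    have adj: "(mat_adjoint (K k) * K k) $$ (x, y) =
        (\<Sum>q<dim_row (K k). cnj (K k $$ (q, x)) * K k $$ (q, y))" if "x < m" "y < m" for x y
      using that d by (simp add: mat_adjoint_def scalar_prod_def lessThan_atLeast0 mat_of_rows_def)
    have "(K k *\<^sub>v v) \<bullet>c (K k *\<^sub>v v) =
        (\<Sum>q<dim_row (K k). (\<Sum>y<m. K k $$ (q, y) * v $ y) * (\<Sum>x<m. cnj (K k $$ (q, x)) * cnj (v $ x)))"
      using d assms(2) by (simp add: scalar_prod_def lessThan_atLeast0)
    also have "\<dots> = (\<Sum>q<dim_row (K k). \<Sum>x<m. \<Sum>y<m.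
        cnj (v $ x) * v $ y * (cnj (K k $$ (q, x)) * K k $$ (q, y)))"
      unfolding sum_product
      by (rule sum.cong[OF refl], subst sum.swap) (simp add: mult_ac)
    also have "\<dots> = (\<Sum>x<m. \<Sum>y<m. \<Sum>q<dim_row (K k).
        cnj (v $ x) * v $ y * (cnj (K k $$ (q, x)) * K k $$ (q, y)))"
      by (subst sum.swap, rule sum.cong[OF refl], rule sum.swap)
    also have "\<dots> = (\<Sum>x<m. \<Sum>y<m. cnj (v $ x) * v $ y * (mat_adjoint (K k) * K k) $$ (x, y))"
      by (intro sum.cong refl) (simp add: adj sum_distrib_left)
    finally show "(K k *\<^sub>v v) \<bullet>c (K k *\<^sub>v v) = \<dots>" .
  qed
  also have "\<dots> = (\<Sum>x<m. \<Sum>y<m. cnj (v $ x) * v $ y * (\<Sum>k<r. (mat_adjoint (K k) * K k) $$ (x, y)))"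
    unfolding sum_distrib_left by (subst sum.swap, rule sum.cong[OF refl], rule sum.swap)
  also have "\<dots> = (\<Sum>x<m. \<Sum>y<m. if x = y then cnj (v $ x) * v $ y else 0)"
  proof (intro sum.cong refl)
    fix x y assume xy: "x \<in> {..<m}" "y \<in> {..<m}"
    have "mat m m (\<lambda>jk. \<Sum>i<r. (mat_adjoint (K i) * K i) $$ jk) $$ (x, y) = 1\<^sub>m m $$ (x, y)"
      using assms(1) by (simp add: measurement_def)
    then show "cnj (v $ x) * v $ y * (\<Sum>k<r. (mat_adjoint (K k) * K k) $$ (x, y)) =
        (if x = y then cnj (v $ x) * v $ y else 0)"
      using xy by simp
  qed
  also have "\<dots> = v \<bullet>c v"
    using assms(2) by (simp add: scalar_prod_def lessThan_atLeast0 mult.commute)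
  finally show ?thesis
    by (metis Re_sum)
qed

text \<open>A product input stays a product along every branch, so its squared norm factorises and
  completeness is applied to the factor of the measuring party alone. Only a bound holds in general
  because \<open>L\<close> may omit some decisions.\<close>

lemma sum_prob_decide_tensor_le:
  assumes "finite L" and "valid_protocol P m n" and "u \<in> carrier_vec m" and "w \<in> carrier_vec n"
  shows "(\<Sum>l\<in>L. prob_decide P m n (tensor m n u w) l) \<le> Re (u \<bullet>c u) * Re (w \<bullet>c w)"
  using assms(2-)
proof (induction P arbitrary: m n u w)
  case (Decide x)
  \<comment> \<open>This covers the case \<open>x \<notin> L\<close>, in which the left-hand side is
    0.\<close>
  have "0 \<le> Re (u \<bullet>c u) * Re (w \<bullet>c w)"
    by (simp add: inner_self_eq sum_nonneg)
  then show ?case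
    using assms(1) Decide by (simp add: inner_tensor)
next
  case (Measure_First r K P)
  have meas: "measurement m r K" using Measure_First.prems(1) by simp
  have K: "dim_col (K k) = m" "valid_protocol (P k) (dim_row (K k)) n" if "k < r" for k
    using Measure_First.prems(1) that by (auto simp: measurement_def)
  have "(\<Sum>l\<in>L. prob_decide (Measure_First r K P) m n (tensor m n u w) l) =
      (\<Sum>k<r. \<Sum>l\<in>L. prob_decide (P k) (dim_row (K k)) n (tensor (dim_row (K k)) n (K k *\<^sub>v u) w) l)"
    using K Measure_First.prems by (subst sum.swap) (simp add: kronecker_first_tensor_sum)
  also have "\<dots> \<le> (\<Sum>k<r. Re ((K k *\<^sub>v u) \<bullet>c (K k *\<^sub>v u)) * Re (w \<bullet>c w))"
    using K Measure_First.prems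
    by (intro sum_mono Measure_First.IH) (auto intro!: mult_mat_vec_carrier)
  also have "\<dots> = Re (u \<bullet>c u) * Re (w \<bullet>c w)"
    using measurement_norm[OF meas, of u] Measure_First.prems by (simp flip: sum_distrib_right)
  finally show ?case .
next
  case (Measure_Second r K P)
  have meas: "measurement n r K" using Measure_Second.prems(1) by simp
  have K: "dim_col (K k) = n" "valid_protocol (P k) m (dim_row (K k))" if "k < r" for k
    using Measure_Second.prems(1) that by (auto simp: measurement_def)
  have "(\<Sum>l\<in>L. prob_decide (Measure_Second r K P) m n (tensor m n u w) l) =
      (\<Sum>k<r. \<Sum>l\<in>L. prob_decide (P k) m (dim_row (K k)) (tensor m (dim_row (K k)) u (K k *\<^sub>v w)) l)"
    using K Measure_Second.prems by (subst sum.swap) (simp add: kronecker_second_tensor_sum)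
  also have "\<dots> \<le> (\<Sum>k<r. Re (u \<bullet>c u) * Re ((K k *\<^sub>v w) \<bullet>c (K k *\<^sub>v w)))"
    using K Measure_Second.prems
    by (intro sum_mono Measure_Second.IH) (auto intro!: mult_mat_vec_carrier)
  also have "\<dots> = Re (u \<bullet>c u) * Re (w \<bullet>c w)"
    using measurement_norm[OF meas, of w] Measure_Second.prems by (simp flip: sum_distrib_left)
  finally show ?case .
qed

text \<open>Leaves evaluate squared norms and the operators before them are linear. Coefficients
  with squared modulus \<open>1 / d\<close> thus become weights \<open>1 / d\<close>.\<close>

lemma prob_decide_smult:
  assumes "valid_protocol P m n" and "\<psi> \<in> carrier_vec (m * n)"
  shows "prob_decide P m n (c \<cdot>\<^sub>v \<psi>) l = (cmod c)\<^sup>2 * prob_decide P m n \<psi> l"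
  using assms
proof (induction P arbitrary: m n \<psi>)
  case (Decide x)
  show ?case
    by (simp add: inner_self_eq norm_mult power_mult_distrib sum_distrib_left)
next
  case (Measure_First r K P)
  have "prob_decide (P k) (dim_row (K k)) n (kronecker (K k) (1\<^sub>m n) *\<^sub>v (c \<cdot>\<^sub>v \<psi>)) l =
      (cmod c)\<^sup>2 * prob_decide (P k) (dim_row (K k)) n (kronecker (K k) (1\<^sub>m n) *\<^sub>v \<psi>) l"
    if "k < r" for k
  proof -
    have K: "kronecker (K k) (1\<^sub>m n) \<in> carrier_mat (dim_row (K k) * n) (m * n)"
      "valid_protocol (P k) (dim_row (K k)) n"
      using Measure_First.prems(1) that by (auto simp: measurement_def kronecker_def)
    then show ?thesis
      using Measure_First.prems(2) by (simp add: mult_mat_vec[OF K(1)] Measure_First.IH)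
  qed
  then show ?case
    by (simp add: sum_distrib_left)
next
  case (Measure_Second r K P)
  have "prob_decide (P k) m (dim_row (K k)) (kronecker (1\<^sub>m m) (K k) *\<^sub>v (c \<cdot>\<^sub>v \<psi>)) l =
      (cmod c)\<^sup>2 * prob_decide (P k) m (dim_row (K k)) (kronecker (1\<^sub>m m) (K k) *\<^sub>v \<psi>) l"
    if "k < r" for k
  proof -
    have K: "kronecker (1\<^sub>m m) (K k) \<in> carrier_mat (m * dim_row (K k)) (m * n)"
      "valid_protocol (P k) m (dim_row (K k))"
      using Measure_Second.prems(1) that by (auto simp: measurement_def kronecker_def)
    then show ?thesis
      using Measure_Second.prems(2) by (simp add: mult_mat_vec[OF K(1)] Measure_Second.IH)
  qed
  then show ?case
    by (simp add: sum_distrib_left)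
qed

section \<open>Maximally entangled states with a common support\<close>

text \<open>
  States \<open>\<Sum>\<^sub>i c\<^sub>i |i\<rangle>|\<pi>(i)\<rangle>\<close> with \<open>|c\<^sub>i|\<^sup>2 = 1 / d\<close> and \<open>\<pi>\<close> a bijection onto a common set \<open>W\<close> of basis
  vectors of the second party: the success probabilities sum up to at most \<open>1 / d\<close> times the
  total probability of all decisions on the \<open>d\<^sup>2\<close> product states \<open>|i\<rangle>|w\<rangle>\<close>, that is, to at most \<open>d\<close>.
\<close>

lemma not_locally_distinguishable_max_entangled:
  assumes "d > 0" and "finite T" and "card T > d" and "W \<subseteq> {..<n}" and "T \<subseteq> S"
    and max_ent: "\<And>\<psi>. \<psi> \<in> T \<Longrightarrow> \<exists>c \<pi>. bij_betw \<pi> {..<d} W \<and> (\<forall>i<d. (cmod (c i))\<^sup>2 = 1 / d) \<and>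
      \<psi> = vec (d * n) (\<lambda>x. if x mod n = \<pi> (x div n) then c (x div n) else 0)"
  shows "\<not> locally_distinguishable d n S"
proof
  assume "locally_distinguishable d n S"
  then obtain P :: "complex vec protocol"
    where P: "valid_protocol P d n" and one: "\<And>\<psi>. \<psi> \<in> T \<Longrightarrow> prob_decide P d n \<psi> \<psi> = 1"
    using assms(5) by (auto simp: locally_distinguishable_def)
  \<comment> \<open>The probability of decision \<open>l\<close> on \<open>|i>|w>\<close>. It
    involves neither \<open>c\<close> nor \<open>\<pi>\<close>, so the bounds for different states
    can be added.\<close>
  define q where "q i w l = prob_decide P d n (tensor d n (unit_vec d i) (unit_vec n w)) l" for i w l
  have bound: "d \<le> (\<Sum>i<d. \<Sum>w\<in>W. q i w \<psi>)" and card_W: "card W = d" if "\<psi> \<in> T" for \<psi>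
  proof -
    from max_ent[OF that] obtain c \<pi> where \<pi>: "bij_betw \<pi> {..<d} W"
      and c: "\<And>i. i < d \<Longrightarrow> (cmod (c i))\<^sup>2 = 1 / d"
      and \<psi>: "\<psi> = vec (d * n) (\<lambda>x. if x mod n = \<pi> (x div n) then c (x div n) else 0)"
      by blast
    have \<pi>_less: "\<pi> i < n" if "i < d" for i
      using \<pi> assms(4) that by (auto simp: bij_betw_def)
    show "card W = d"
      using bij_betw_same_card[OF \<pi>] by simp
    \<comment> \<open>At index \<open>x\<close> only the term \<open>i = x div n\<close>
      survives.\<close>
    have \<psi>_sum: "\<psi> = tensor_sum d n {..<d} (\<lambda>i. c i \<cdot>\<^sub>v unit_vec d i) (\<lambda>i. unit_vec n (\<pi> i))"
    proof (rule eq_vecI)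
      fix x assume "x < dim_vec (tensor_sum d n {..<d} (\<lambda>i. c i \<cdot>\<^sub>v unit_vec d i) (\<lambda>i. unit_vec n (\<pi> i)))"
      then have x: "x < d * n" by (simp add: tensor_sum_def)
      have "(\<Sum>i<d. (c i \<cdot>\<^sub>v unit_vec d i) $ (x div n) * unit_vec n (\<pi> i) $ (x mod n)) =
          (\<Sum>i<d. if x div n = i then (if x mod n = \<pi> i then c i else 0) else 0)"
        using div_less_mult[OF x] mod_less_mult[OF x] \<pi>_less
        by (intro sum.cong refl) (auto simp: unit_vec_def)
      then show "\<psi> $ x =
          tensor_sum d n {..<d} (\<lambda>i. c i \<cdot>\<^sub>v unit_vec d i) (\<lambda>i. unit_vec n (\<pi> i)) $ x"
        using x div_less_mult[OF x] by (simp add: \<psi> tensor_sum_def)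
    qed (simp add: \<psi> tensor_sum_def)
    have "1 \<le> (\<Sum>i<d. \<Sum>j<d.
        prob_decide P d n (tensor d n (c i \<cdot>\<^sub>v unit_vec d i) (unit_vec n (\<pi> j))) \<psi>)"
      using prob_decide_tensor_sum_le[of P d n "{..<d}" "\<lambda>i. c i \<cdot>\<^sub>v unit_vec d i"
          "\<lambda>i. unit_vec n (\<pi> i)" \<psi>] P one[OF that] by (simp flip: \<psi>_sum)
    also have "\<dots> = (\<Sum>i<d. \<Sum>j<d. q i (\<pi> j) \<psi> / d)"
    proof (intro sum.cong refl)
      fix i j assume "i \<in> {..<d}" "j \<in> {..<d}"
      have "tensor d n (c i \<cdot>\<^sub>v unit_vec d i) (unit_vec n (\<pi> j)) =
          c i \<cdot>\<^sub>v tensor d n (unit_vec d i) (unit_vec n (\<pi> j))"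
        by (intro eq_vecI) (auto simp: tensor_sum_def div_less_mult)
      then show "prob_decide P d n (tensor d n (c i \<cdot>\<^sub>v unit_vec d i) (unit_vec n (\<pi> j))) \<psi> =
          q i (\<pi> j) \<psi> / d"
        using prob_decide_smult[OF P, of "tensor d n (unit_vec d i) (unit_vec n (\<pi> j))" "c i" \<psi>]
          c \<open>i \<in> {..<d}\<close> by (simp add: q_def) (simp add: tensor_sum_def)
    qed
    \<comment> \<open>Since \<open>j\<close> runs independently of \<open>i\<close>, the bijection
      \<open>\<pi>\<close> disappears by reindexing and only its range \<open>W\<close>
      remains.\<close>
    also have "\<dots> = (\<Sum>i<d. \<Sum>w\<in>W. q i w \<psi> / d)"
      using \<pi> by (intro sum.cong refl sum.reindex_bij_betw)
    finally show "d \<le> (\<Sum>i<d. \<Sum>w\<in>W. q i w \<psi>)"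
      by (cases "d = 0") (simp_all add: field_simps flip: sum_divide_distrib)
  qed
  have "T \<noteq> {}" using assms(3) by auto
  then have W: "card W = d" using card_W by auto
  \<comment> \<open>Double counting: the bounds are added over \<open>T\<close> and the sums
    exchanged. Each of the \<open>d * d\<close> product states then contributes at most 1.\<close>
  have "d * card T \<le> (\<Sum>\<psi>\<in>T. \<Sum>i<d. \<Sum>w\<in>W. q i w \<psi>)"
    using sum_mono[of T "\<lambda>_. real d" "\<lambda>\<psi>. \<Sum>i<d. \<Sum>w\<in>W. q i w \<psi>"] bound by (simp add: mult.commute)
  also have "\<dots> = (\<Sum>i<d. \<Sum>w\<in>W. \<Sum>\<psi>\<in>T. q i w \<psi>)"
    by (subst sum.swap, rule sum.cong[OF refl], rule sum.swap)
  also have "\<dots> \<le> (\<Sum>i<d. \<Sum>w\<in>W. 1)"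
  proof (intro sum_mono)
    fix i w assume "i \<in> {..<d}" "w \<in> W"
    then have "i < d" "w < n" using assms(4) by auto
    then show "(\<Sum>\<psi>\<in>T. q i w \<psi>) \<le> 1"
      using sum_prob_decide_tensor_le[OF assms(2) P, of "unit_vec d i" "unit_vec n w"]
      by (simp add: q_def)
  qed
  also have "\<dots> = d * d" using W by simp
  finally have "d * card T \<le> d * d" by linarith
  then show False using assms(1,3) by simp
qed

section \<open>Lattice-type GHZ states\<close>

lemma qubit_less: "qubit t a k < 2"
  by (simp add: qubit_def)

text \<open>Qubits are counted from the most significant bit, so halving the index drops the last
  qubit and leaves the numbers of the others unchanged.\<close>

lemma qubit_Suc: "k < t \<Longrightarrow> qubit (Suc t) a k = qubit t (a div 2) k"
proof -
  assume "k < t"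
  then have "Suc t - 1 - k = Suc (t - 1 - k)" by simp
  then show ?thesis by (simp add: qubit_def div_mult2_eq)
qed

lemma qubit_Suc_last: "qubit (Suc t) a t = a mod 2"
  by (simp add: qubit_def)

text \<open>The indices below \<open>2 ^ t\<close> run through all bit strings of length
  \<open>t\<close>, so this is the distributive law. The induction splits off the last bit.\<close>

lemma sum_prod_qubit:
  fixes f :: "nat \<Rightarrow> nat \<Rightarrow> 'a :: comm_semiring_1"
  shows "(\<Sum>a<2 ^ t. \<Prod>k<t. f k (qubit t a k)) = (\<Prod>k<t. f k 0 + f k 1)"
proof (induction t)
  case (Suc t)
  have "(\<Sum>a<2 ^ Suc t. \<Prod>k<Suc t. f k (qubit (Suc t) a k)) =
      (\<Sum>x<2 ^ t. \<Sum>y<2. (\<Prod>k<t. f k (qubit t x k)) * f t y)"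
    unfolding power_Suc2 sum_lessThan_mult
    by (intro sum.cong refl) (simp add: qubit_Suc qubit_Suc_last)
  also have "\<dots> = (\<Prod>k<Suc t. f k 0 + f k 1)"
    by (simp add: lessThan_nat_numeral Suc.IH add.commute flip: distrib_left sum_distrib_right)
  finally show ?case .
qed (simp add: qubit_def)

lemma qubit_inject:
  assumes "a < 2 ^ t" and "b < 2 ^ t" and "\<And>k. k < t \<Longrightarrow> qubit t a k = qubit t b k"
  shows "a = b"
  using assms
proof (induction t arbitrary: a b)
  case (Suc t)
  have "a div 2 = b div 2"
  proof (rule Suc.IH)
    show "qubit t (a div 2) k = qubit t (b div 2) k" if "k < t" for k
      using Suc.prems(3)[of k] that by (simp add: qubit_Suc)
  qed (use Suc.prems in auto)
  moreover have "a mod 2 = b mod 2"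
    using Suc.prems(3)[of t] by (simp add: qubit_Suc_last)
  ultimately show ?case
    by (metis div_mult_mod_eq)
qed simp

text \<open>\<open>2 ^ t - 1\<close> has all bits 1, so subtracting from it never borrows and flips
  every bit.\<close>

lemma qubit_complement:
  assumes "a < 2 ^ t" and "k < t"
  shows "qubit t (2 ^ t - 1 - a) k = 1 - qubit t a k"
  using assms
proof (induction t arbitrary: a)
  case (Suc t)
  define p x y where "p = (2 :: nat) ^ t" and "x = a div 2" and "y = a mod 2"
  have a: "a = 2 * x + y" and "y < 2"
    by (simp_all add: x_def y_def)
  with Suc.prems(1) have "x < p" by (simp add: p_def)
  \<comment> \<open>Quotient and remainder modulo 2 of the complement: the remaining bits and the
    last bit are complemented separately.\<close>
  with \<open>y < 2\<close> have "2 ^ Suc t - 1 - a = (1 - y) + (p - 1 - x) * 2"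
    by (simp add: a flip: p_def)
  moreover have "(z + u * 2) div 2 = u \<and> (z + u * 2) mod 2 = z" if "z < 2" for z u :: nat
    using that by simp
  moreover have "1 - y < 2" by simp
  ultimately have "(2 ^ Suc t - 1 - a) div 2 = p - 1 - x \<and> (2 ^ Suc t - 1 - a) mod 2 = 1 - y"
    by metis
  then have *: "(2 ^ Suc t - 1 - a) div 2 = 2 ^ t - 1 - a div 2" "(2 ^ Suc t - 1 - a) mod 2 = 1 - a mod 2"
    unfolding p_def x_def y_def by blast+
  show ?case
  proof (cases "k = t")
    case True
    then show ?thesis using * by (simp add: qubit_Suc_last)
  next
    case False
    then show ?thesis
      using Suc.IH[of "a div 2"] Suc.prems * by (simp add: qubit_Suc)
  qed
qed simp

section \<open>Amplitudes and orthonormality of GHZ lattices\<close>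

text \<open>The two kets of \<open>ghz v\<close> have the complementary indices \<open>v\<close> and
  \<open>7 - v\<close>. The smaller one, with first qubit 0, always has sign plus; the larger one
  carries the sign of the state.\<close>

lemma ghz_index:
  assumes "v < 8" and "i < 8"
  shows "ghz v $ i = (if i = min v (7 - v) then 1
    else if i = max v (7 - v) then if v \<le> 3 then 1 else - 1 else 0) / complex_of_real (sqrt 2)"
proof -
  have "v \<in> {0, 1, 2, 3, 4, 5, 6, 7}" "i \<in> {0, 1, 2, 3, 4, 5, 6, 7}"
    using assms by auto
  then show ?thesis
    by (elim insertE emptyE) (simp_all add: ghz_def ket3_def unit_vec_def)
qed

lemma dim_ghz: "v < 8 \<Longrightarrow> dim_vec (ghz v) = 8"
proof -
  assume "v < 8"
  then have "v \<in> {0, 1, 2, 3, 4, 5, 6, 7}" by auto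
  then show ?thesis
    by (elim insertE emptyE) (simp_all add: ghz_def ket3_def)
qed

lemma sum_lessThan_8:
  "(\<Sum>i<8. f i) = f 0 + f 1 + f 2 + f 3 + f 4 + f 5 + f 6 + f (7 :: nat)"
  by (simp add: eval_nat_numeral add_ac)

lemma ghz_inner:
  assumes "v < 8" and "w < 8"
  shows "ghz v \<bullet>c ghz w = (if v = w then 1 else 0)"
proof -
  have "ghz v \<bullet>c ghz w = (\<Sum>i<8. ghz v $ i * cnj (ghz w $ i))"
    using assms by (simp add: scalar_prod_def dim_ghz lessThan_atLeast0)
  moreover have "v \<in> {0, 1, 2, 3, 4, 5, 6, 7}" "w \<in> {0, 1, 2, 3, 4, 5, 6, 7}"
    using assms by auto
  moreover have "complex_of_real (sqrt 2) * complex_of_real (sqrt 2) = 2"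
    by (metis abs_numeral of_real_mult of_real_numeral real_sqrt_mult_self)
  ultimately show ?thesis
    unfolding sum_lessThan_8 by (elim insertE emptyE) (simp_all add: ghz_index)
qed

lemma dim_lattice_ghz: "dim_vec (lattice_ghz v) = 2 ^ length v * 2 ^ length v * 2 ^ length v"
  by (simp add: lattice_ghz_def tripartite_vec_def Let_def)

lemma lattice_ghz_index:
  assumes "length v = t" and "a < 2 ^ t" and "b < 2 ^ t" and "c < 2 ^ t"
  shows "lattice_ghz v $ ((a * 2 ^ t + b) * 2 ^ t + c) =
    (\<Prod>k<t. ghz (v ! k) $ (4 * qubit t a k + 2 * qubit t b k + qubit t c k))"
proof -
  have ab: "a * 2 ^ t + b < 2 ^ t * 2 ^ t"
    using add_mult_less[OF assms(2,3)] by (simp add: add.commute)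
  have "(a * 2 ^ t + b) * 2 ^ t + c < 2 ^ t * 2 ^ t * 2 ^ t"
    using add_mult_less[OF ab assms(4)] by (simp add: add.commute)
  moreover have "((a * 2 ^ t + b) * 2 ^ t + c) div 2 ^ t = a * 2 ^ t + b"
      "((a * 2 ^ t + b) * 2 ^ t + c) mod 2 ^ t = c"
    using assms by simp_all
  moreover have "(a * 2 ^ t + b) div 2 ^ t = a" "(a * 2 ^ t + b) mod 2 ^ t = b"
    using assms by simp_all
  ultimately show ?thesis
    using assms(1) by (simp add: lattice_ghz_def tripartite_vec_def Let_def div_mult2_eq)
qed

text \<open>Amplitudes are products over the levels and the sum runs over all bit strings of the
  three parties, so \<open>sum_prod_qubit\<close>, applied to \<open>c\<close>, \<open>b\<close> and
  \<open>a\<close> in turn, moves the sums inside the product.\<close>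

lemma lattice_ghz_inner:
  assumes "length v = t" and "length w = t" and "set v \<subseteq> {0..7}" and "set w \<subseteq> {0..7}"
  shows "lattice_ghz v \<bullet>c lattice_ghz w = (\<Prod>k<t. ghz (v ! k) \<bullet>c ghz (w ! k))"
proof -
  \<comment> \<open>The contribution of level \<open>k\<close> when the parties hold the qubits
    \<open>i\<close>, \<open>j\<close>, \<open>l\<close> there.\<close>
  define g where "g k i j l = ghz (v ! k) $ (4 * i + 2 * j + l) * cnj (ghz (w ! k) $ (4 * i + 2 * j + l))"
    for k i j l
  have "lattice_ghz v \<bullet>c lattice_ghz w =
      (\<Sum>x<2 ^ t * 2 ^ t * 2 ^ t. lattice_ghz v $ x * cnj (lattice_ghz w $ x))"
    using assms by (simp add: scalar_prod_def dim_lattice_ghz lessThan_atLeast0)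
  also have "\<dots> = (\<Sum>a<2 ^ t. \<Sum>b<2 ^ t. \<Sum>c<2 ^ t. \<Prod>k<t. g k (qubit t a k) (qubit t b k) (qubit t c k))"
    unfolding sum_lessThan_mult
  proof (intro sum.cong refl)
    fix a b c :: nat
    assume "a \<in> {..<2 ^ t}" "b \<in> {..<2 ^ t}" "c \<in> {..<2 ^ t}"
    moreover have "c + (b + a * 2 ^ t) * 2 ^ t = (a * 2 ^ t + b) * 2 ^ t + c"
      by simp
    ultimately show "lattice_ghz v $ (c + (b + a * 2 ^ t) * 2 ^ t) *
        cnj (lattice_ghz w $ (c + (b + a * 2 ^ t) * 2 ^ t)) =
        (\<Prod>k<t. g k (qubit t a k) (qubit t b k) (qubit t c k))"
      using assms by (simp only: lattice_ghz_index lessThan_iff) (simp add: g_def prod.distrib)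
  qed
  also have "\<dots> = (\<Sum>a<2 ^ t. \<Sum>b<2 ^ t. \<Prod>k<t.
      g k (qubit t a k) (qubit t b k) 0 + g k (qubit t a k) (qubit t b k) 1)"
    by (intro sum.cong refl sum_prod_qubit)
  also have "\<dots> = (\<Sum>a<2 ^ t. \<Prod>k<t.
      (g k (qubit t a k) 0 0 + g k (qubit t a k) 0 1) + (g k (qubit t a k) 1 0 + g k (qubit t a k) 1 1))"
    by (intro sum.cong refl sum_prod_qubit[where f = "\<lambda>k j. g k (qubit t _ k) j 0 + g k (qubit t _ k) j 1"])
  also have "\<dots> = (\<Prod>k<t. ((g k 0 0 0 + g k 0 0 1) + (g k 0 1 0 + g k 0 1 1)) +
      ((g k 1 0 0 + g k 1 0 1) + (g k 1 1 0 + g k 1 1 1)))"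
    by (rule sum_prod_qubit[where f = "\<lambda>k i. (g k i 0 0 + g k i 0 1) + (g k i 1 0 + g k i 1 1)"])
  also have "\<dots> = (\<Prod>k<t. ghz (v ! k) \<bullet>c ghz (w ! k))"
  proof (intro prod.cong refl)
    fix k assume "k \<in> {..<t}"
    then have "v ! k \<in> {0..7}" "w ! k \<in> {0..7}"
      using assms by (auto intro!: subsetD[OF _ nth_mem] simp del: atLeastAtMost_iff)
    then have "ghz (v ! k) \<bullet>c ghz (w ! k) = (\<Sum>i<8. ghz (v ! k) $ i * cnj (ghz (w ! k) $ i))"
      by (simp add: scalar_prod_def dim_ghz lessThan_atLeast0)
    then show "((g k 0 0 0 + g k 0 0 1) + (g k 0 1 0 + g k 0 1 1)) +
      ((g k 1 0 0 + g k 1 0 1) + (g k 1 1 0 + g k 1 1 1)) = ghz (v ! k) \<bullet>c ghz (w ! k)"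
      unfolding sum_lessThan_8 by (simp add: g_def add_ac numeral_2_eq_2 numeral_3_eq_3)
  qed
  finally show ?thesis .
qed

lemma lattice_ghz_orthonormal:
  assumes "length v = t" and "length w = t" and "set v \<subseteq> {0..7}" and "set w \<subseteq> {0..7}"
  shows "lattice_ghz v \<bullet>c lattice_ghz w = (if v = w then 1 else 0)"
proof -
  have "v ! k \<in> {0..7}" "w ! k \<in> {0..7}" if "k < t" for k
    using assms that by (auto intro!: subsetD[OF _ nth_mem] simp del: atLeastAtMost_iff)
  then have "(\<Prod>k<t. ghz (v ! k) \<bullet>c ghz (w ! k)) = (\<Prod>k<t. if v ! k = w ! k then 1 else 0)"
    by (intro prod.cong refl) (force simp: ghz_inner)
  then have "lattice_ghz v \<bullet>c lattice_ghz w = (\<Prod>k<t. if v ! k = w ! k then 1 else 0)"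
    using assms by (simp add: lattice_ghz_inner)
  also have "\<dots> = (if v = w then 1 else 0)"
    using assms(1,2) by (auto simp: list_eq_iff_nth_eq)
  finally show ?thesis .
qed

section \<open>Cyclic symmetry\<close>

text \<open>
  Cycling the parties maps \<open>\<psi>\<^sub>1 \<mapsto> \<psi>\<^sub>2 \<mapsto> \<psi>\<^sub>3 \<mapsto> \<psi>\<^sub>1\<close> and fixes \<open>\<psi>\<^sub>0\<close> and \<open>\<psi>\<^sub>7\<close>. (It maps \<open>\<psi>\<^sub>5\<close> to \<open>- \<psi>\<^sub>4\<close>,
  so that the indices 4, 5, 6 would require signs.)
\<close>

definition cycle_index :: "nat \<Rightarrow> nat" where
  "cycle_index v = (if v \<in> {1, 2} then v + 1 else if v = 3 then 1 else v)"

lemma ghz_cycle_index: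
  assumes "v \<in> {0, 1, 2, 3, 7}" and "i < 2" and "j < 2" and "l < 2"
  shows "ghz (cycle_index v) $ (4 * j + 2 * l + i) = ghz v $ (4 * i + 2 * j + l)"
proof -
  have "i \<in> {0, 1}" "j \<in> {0, 1}" "l \<in> {0, 1}" using assms by auto
  with assms(1) show ?thesis
    by (elim insertE emptyE) (simp_all add: cycle_index_def ghz_index)
qed

text \<open>Cycling permutes the three qubits in the same way at every level, so the one-level rule
  applies factor by factor.\<close>

lemma cycle_parties_lattice_ghz:
  assumes "set v \<subseteq> {0, 1, 2, 3, 7}" and "d = 2 ^ length v"
  shows "cycle_parties d d d (lattice_ghz v) = lattice_ghz (map cycle_index v)"
proof -
  define t where "t = length v"
  have "cycle_parties d d d (lattice_ghz v) $ x = lattice_ghz (map cycle_index v) $ x"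
    if x: "x < d * d * d" for x
  proof -
    \<comment> \<open>After cycling, the digits of \<open>x\<close> in base \<open>d\<close> belong
      to \<open>B\<close>, \<open>C\<close>, \<open>A\<close> in this order.\<close>
    define b c a where "b = x div (d * d)" and "c = x div d mod d" and "a = x mod d"
    have less: "a < 2 ^ t" "b < 2 ^ t" "c < 2 ^ t"
      using x assms(2) by (auto simp: a_def b_def c_def t_def less_mult_imp_div_less mult.assoc)
    have "cycle_parties d d d (lattice_ghz v) $ x = lattice_ghz v $ ((a * 2 ^ t + b) * 2 ^ t + c)"
      using x assms(2) by (simp add: cycle_parties_def tripartite_vec_def a_def b_def c_def t_def)
    also have "\<dots> = (\<Prod>k<t. ghz (v ! k) $ (4 * qubit t a k + 2 * qubit t b k + qubit t c k))"
      using less by (intro lattice_ghz_index) (simp_all add: t_def)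
    also have "\<dots> = (\<Prod>k<t. ghz (map cycle_index v ! k) $ (4 * qubit t b k + 2 * qubit t c k + qubit t a k))"
    proof (intro prod.cong refl)
      fix k assume "k \<in> {..<t}"
      then have "k < length v" by (simp add: t_def)
      moreover from this have "v ! k \<in> {0, 1, 2, 3, 7}"
        using assms(1) nth_mem by blast
      ultimately show "ghz (v ! k) $ (4 * qubit t a k + 2 * qubit t b k + qubit t c k) =
          ghz (map cycle_index v ! k) $ (4 * qubit t b k + 2 * qubit t c k + qubit t a k)"
        by (simp add: ghz_cycle_index qubit_less)
    qed
    also have "\<dots> = lattice_ghz (map cycle_index v) $ x"
      using x assms(2) by (simp add: lattice_ghz_def tripartite_vec_def Let_def a_def b_def c_def t_def)
    finally show ?thesis .
  qed
  then show ?thesis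
    using assms(2)
    by (intro eq_vecI) (simp_all add: dim_lattice_ghz cycle_parties_def tripartite_vec_def)
qed

section \<open>Lattice states as maximally entangled states\<close>

text \<open>
  With respect to \<open>A|BC\<close>, the hypothesis says that at each level the qubits of \<open>B\<close> and \<open>C\<close> agree,
  and that they differ from the qubit of \<open>A\<close> iff \<open>flip\<close> holds.
\<close>

lemma lattice_ghz_max_entangled:
  assumes "length v = t" and "d = 2 ^ t"
    and amp: "\<And>k i j l. k < t \<Longrightarrow> i < 2 \<Longrightarrow> j < 2 \<Longrightarrow> l < 2 \<Longrightarrow>
      (cmod (ghz (v ! k) $ (4 * i + 2 * j + l)))\<^sup>2 = (if j = l \<and> (j \<noteq> i) = flip then 1 / 2 else 0)"
  shows "\<exists>c \<pi>. bij_betw \<pi> {..<d} ((\<lambda>b. b * d + b) ` {..<d}) \<and> (\<forall>a<d. (cmod (c a))\<^sup>2 = 1 / d) \<and>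
    lattice_ghz v = vec (d * (d * d)) (\<lambda>x. if x mod (d * d) = \<pi> (x div (d * d)) then c (x div (d * d)) else 0)"
proof -
  \<comment> \<open>The only index that \<open>B\<close> and \<open>C\<close> can both hold when
    \<open>A\<close> holds \<open>a\<close>: \<open>a\<close> itself or its bitwise
    complement.\<close>
  define f where "f a = (if flip then d - 1 - a else a)" for a
  define c where "c a = lattice_ghz v $ ((a * d + f a) * d + f a)" for a
  define \<pi> where "\<pi> a = f a * d + f a" for a
  have f_less: "f a < 2 ^ t" if "a < 2 ^ t" for a
    using that assms(2) by (auto simp: f_def)
  have f_qubit: "(qubit t (f a) k \<noteq> qubit t a k) = flip" if "a < 2 ^ t" "k < t" for a k
  proof -
    have "1 - qubit t a k \<noteq> qubit t a k" by presburger
    then show ?thesis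
      using qubit_complement[OF that] assms(2) by (simp add: f_def)
  qed
  have "bij_betw f {..<d} {..<d}"
    \<comment> \<open>\<open>f\<close> is its own inverse.\<close>
    by (rule bij_betwI[of _ _ _ f]) (auto simp: f_def)
  moreover have "inj_on (\<lambda>b. b * d + b) {..<d}"
    by (rule inj_onI) (metis add.commute mult_Suc_right mult_cancel2 nat.distinct(1))
  ultimately have \<pi>: "bij_betw \<pi> {..<d} ((\<lambda>b. b * d + b) ` {..<d})"
    using bij_betw_trans[of f "{..<d}" "{..<d}" "\<lambda>b. b * d + b"]
    by (simp add: \<pi>_def[abs_def] o_def inj_on_imp_bij_betw)
  have norm_amp: "(cmod (lattice_ghz v $ ((a * d + b) * d + e)))\<^sup>2 =
      (\<Prod>k<t. if qubit t b k = qubit t e k \<and> (qubit t b k \<noteq> qubit t a k) = flip then 1 / 2 else 0)"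
    if "a < 2 ^ t" "b < 2 ^ t" "e < 2 ^ t" for a b e
  proof -
    have "(cmod (lattice_ghz v $ ((a * d + b) * d + e)))\<^sup>2 =
        (\<Prod>k<t. (cmod (ghz (v ! k) $ (4 * qubit t a k + 2 * qubit t b k + qubit t e k)))\<^sup>2)"
      unfolding assms(2) lattice_ghz_index[OF assms(1) that] by (simp only: prod_norm[symmetric] prod_power_distrib)
    also have "\<dots> = (\<Prod>k<t. if qubit t b k = qubit t e k \<and> (qubit t b k \<noteq> qubit t a k) = flip then 1 / 2 else 0)"
      by (intro prod.cong refl amp) (auto simp: qubit_less)
    finally show ?thesis .
  qed
  have c: "(cmod (c a))\<^sup>2 = 1 / d" if "a < d" for a
  proof -
    have a: "a < 2 ^ t" using that assms(2) by simp
    have "(cmod (c a))\<^sup>2 = (\<Prod>k<t. 1 / 2)"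
      unfolding c_def norm_amp[OF a f_less[OF a] f_less[OF a]]
      using f_qubit[OF a] by (intro prod.cong refl) auto
    then show ?thesis
      using assms(2) by (simp add: power_one_over)
  qed
  \<comment> \<open>An index other than \<open>f a\<close> has a wrong bit at some level, and the
    amplitude factor of that level vanishes.\<close>
  have zero: "lattice_ghz v $ ((a * d + b) * d + e) = 0"
    if less: "a < 2 ^ t" "b < 2 ^ t" "e < 2 ^ t" and ne: "\<not> (b = f a \<and> e = f a)" for a b e
  proof -
    obtain k where k: "k < t" "qubit t b k \<noteq> qubit t (f a) k \<or> qubit t e k \<noteq> qubit t (f a) k"
      using qubit_inject[OF less(2) f_less[OF less(1)]] qubit_inject[OF less(3) f_less[OF less(1)]] ne
      by blast
    have "\<not> (qubit t b k = qubit t e k \<and> (qubit t b k \<noteq> qubit t a k) = flip)"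
      using k f_qubit[OF less(1) k(1)] qubit_less[of t b k] qubit_less[of t e k]
        qubit_less[of t a k] qubit_less[of t "f a" k] by (auto simp: less_2_cases_iff)
    then have "(cmod (lattice_ghz v $ ((a * d + b) * d + e)))\<^sup>2 = 0"
      unfolding norm_amp[OF less] using k(1) by (auto intro!: prod_zero)
    then show ?thesis by simp
  qed
  have "lattice_ghz v = vec (d * (d * d)) (\<lambda>x. if x mod (d * d) = \<pi> (x div (d * d)) then c (x div (d * d)) else 0)"
  proof (rule eq_vecI)
    fix x
    assume "x < dim_vec (vec (d * (d * d)) (\<lambda>x. if x mod (d * d) = \<pi> (x div (d * d)) then c (x div (d * d)) else 0))"
    then have x: "x < d * (d * d)" by simp
    define a b e where "a = x div (d * d)" and "b = x mod (d * d) div d" and "e = x mod (d * d) mod d"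
    have less: "a < 2 ^ t" "b < 2 ^ t" "e < 2 ^ t"
      using div_less_mult[OF x] mod_less_mult[OF x] assms(2)
      by (auto simp: a_def b_def e_def less_mult_imp_div_less)
    have mod: "x mod (d * d) = b * d + e"
      by (simp add: b_def e_def)
    have "x = a * (d * d) + x mod (d * d)"
      by (simp only: a_def div_mult_mod_eq)
    then have x_eq: "x = (a * d + b) * d + e"
      by (simp add: mod algebra_simps)
    \<comment> \<open>Both sides of the second equation are two-digit expansions in base
      \<open>d\<close>, so the digits agree.\<close>
    have "b = f a \<and> e = f a \<longleftrightarrow> b * d + e = \<pi> a"
    proof
      assume "b * d + e = \<pi> a"
      then have "(b * d + e) div d = (f a * d + f a) div d" "(b * d + e) mod d = (f a * d + f a) mod d"
        by (simp_all add: \<pi>_def)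
      then show "b = f a \<and> e = f a"
        using less f_less[of a] assms(2) by simp
    qed (simp add: \<pi>_def)
    then have "lattice_ghz v $ x = (if x mod (d * d) = \<pi> a then c a else 0)"
      using zero[OF less] unfolding mod by (auto simp: x_eq c_def)
    then show "lattice_ghz v $ x =
        vec (d * (d * d)) (\<lambda>x. if x mod (d * d) = \<pi> (x div (d * d)) then c (x div (d * d)) else 0) $ x"
      using x by (simp add: a_def)
  qed (simp add: dim_lattice_ghz assms)
  with \<pi> c show ?thesis by blast
qed

section \<open>The witness set\<close>

theorem theorem2:
  fixes t d :: nat
  assumes "t \<ge> 1" and "d = 2 ^ t"
  shows "\<exists>S \<subseteq> lattice_ghz_states t. card S = d + 3 \<and> genuinely_nonlocal d d d S"
proof -
  define Z where "Z = {v :: nat list. set v \<subseteq> {0, 7} \<and> length v = t}"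
  \<comment> \<open>One extra word per bipartition: in \<open>ghz 3\<close> the qubits of
    \<open>B\<close> and \<open>C\<close> agree and differ from that of \<open>A\<close>. The states
    \<open>ghz 2\<close> and \<open>ghz 1\<close> single out \<open>B\<close> and \<open>C\<close>
    in the same way.\<close>
  define V where "V = insert (replicate t 1) (insert (replicate t 2) (insert (replicate t 3) Z))"
  define S where "S = lattice_ghz ` V"
  define T where "T = lattice_ghz ` insert (replicate t 3) Z"
  have Z: "finite Z" "card Z = d"
    using finite_lists_length_eq[of "{0, 7 :: nat}" t] card_lists_length_eq[of "{0, 7 :: nat}" t] assms(2)
    by (simp_all add: Z_def numeral_2_eq_2)
  have V: "length v = t" "set v \<subseteq> {0, 1, 2, 3, 7}" "set v \<subseteq> {0..7}" if "v \<in> V" for v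
    using that by (auto simp: V_def Z_def)
  have inner: "lattice_ghz v \<bullet>c lattice_ghz w = (if v = w then 1 else 0)" if "v \<in> V" "w \<in> V" for v w
    using that V by (intro lattice_ghz_orthonormal)
  have inj: "inj_on lattice_ghz V"
  proof (rule inj_onI)
    fix v w assume "v \<in> V" "w \<in> V" "lattice_ghz v = lattice_ghz w"
    then show "v = w" using inner[of v w] inner[of w w] by (simp split: if_splits)
  qed
  \<comment> \<open>Here \<open>t \<ge> 1\<close> matters: for \<open>t = 0\<close> each of these
    words would be the empty word, which lies in \<open>Z\<close>.\<close>
  have notin: "replicate t j \<notin> Z" if "j \<in> {1, 2, 3}" for j
    using assms(1) that by (auto simp: Z_def)
  have "card V = d + 3"
    using Z notin assms(1) by (simp add: V_def replicate_eq_replicate)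
  then have card_S: "card S = d + 3"
    using inj by (simp add: S_def card_image)
  have "inj_on lattice_ghz (insert (replicate t 3) Z)"
    using inj by (rule inj_on_subset) (auto simp: V_def)
  then have card_T: "card T = d + 1"
    using Z notin by (simp add: T_def card_image)
  \<comment> \<open>Words in \<open>Z\<close> are fixed and the three constant words permuted, so
    all three bipartitions pose the same problem.\<close>
  have cycle: "cycle_parties d d d ` S = S"
  proof -
    have "cycle_parties d d d ` S = lattice_ghz ` map cycle_index ` V"
      unfolding S_def image_image
      using V assms(2) by (intro image_cong refl cycle_parties_lattice_ghz) auto
    moreover have "map cycle_index ` Z = Z"
    proof -
      have "map cycle_index v = v" if "v \<in> Z" for v
        using that by (intro map_idI) (auto simp: Z_def cycle_index_def)
      then show ?thesis by simp
    qed
    then have "map cycle_index ` V = V"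
      by (auto simp: V_def cycle_index_def)
    ultimately show ?thesis by (simp add: S_def)
  qed
  have "\<not> locally_distinguishable d (d * d) S"
  proof (rule not_locally_distinguishable_max_entangled)
    show "card T > d" "finite T" "T \<subseteq> S" "d > 0"
      using card_T Z(1) assms(2) by (auto simp: T_def S_def V_def)
    show "(\<lambda>b. b * d + b) ` {..<d} \<subseteq> {..<d * d}"
      using add_mult_less by (auto simp: add.commute)
  next
    fix \<psi> assume "\<psi> \<in> T"
    then obtain v where v: "v \<in> insert (replicate t 3) Z" and \<psi>: "\<psi> = lattice_ghz v"
      by (auto simp: T_def)
    have "length v = t" using v by (auto simp: Z_def)
    \<comment> \<open>The flag \<open>flip\<close> is taken as \<open>v = replicate t 3\<close>: for
      words in \<open>Z\<close> all three qubits agree at each level.\<close>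
    have "(cmod (ghz (v ! k) $ (4 * i + 2 * j + l)))\<^sup>2 =
        (if j = l \<and> (j \<noteq> i) = (v = replicate t 3) then 1 / 2 else 0)"
      if "k < t" "i < 2" "j < 2" "l < 2" for k i j l
    proof -
      have "v = replicate t 3 \<and> v ! k = 3 \<or> v \<noteq> replicate t 3 \<and> v ! k \<in> {0, 7}"
      proof (cases "v = replicate t 3")
        case False
        then have "set v \<subseteq> {0, 7}" using v by (simp add: Z_def)
        then show ?thesis
          using False \<open>k < t\<close> \<open>length v = t\<close> nth_mem by blast
      qed (use \<open>k < t\<close> in simp)
      moreover have "i \<in> {0, 1}" "j \<in> {0, 1}" "l \<in> {0, 1}" using that by auto
      ultimately show ?thesis
        by (elim insertE emptyE disjE conjE) (simp_all add: ghz_index norm_divide power_divide)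
    qed
    then show "\<exists>c \<pi>. bij_betw \<pi> {..<d} ((\<lambda>b. b * d + b) ` {..<d}) \<and> (\<forall>a<d. (cmod (c a))\<^sup>2 = 1 / d) \<and>
        \<psi> = vec (d * (d * d)) (\<lambda>x. if x mod (d * d) = \<pi> (x div (d * d)) then c (x div (d * d)) else 0)"
      unfolding \<psi> by (intro lattice_ghz_max_entangled[OF \<open>length v = t\<close> assms(2)])
  qed
  moreover have "orthonormal_states (d * d * d) S"
    unfolding orthonormal_states_def
  proof (intro conjI)
    show "S \<subseteq> carrier_vec (d * d * d)"
    proof
      fix \<psi> assume "\<psi> \<in> S"
      then obtain v where "v \<in> V" "\<psi> = lattice_ghz v" by (auto simp: S_def)
      then have "dim_vec \<psi> = d * d * d"
        by (simp only: dim_lattice_ghz V(1) assms(2))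
      then show "\<psi> \<in> carrier_vec (d * d * d)"
        by (rule carrier_vecI)
    qed
    show "\<forall>\<psi>\<in>S. \<psi> \<bullet>c \<psi> = 1"
    proof
      fix \<psi> assume "\<psi> \<in> S"
      then obtain v where "v \<in> V" "\<psi> = lattice_ghz v" by (auto simp: S_def)
      then show "\<psi> \<bullet>c \<psi> = 1" using inner[of v v] by simp
    qed
    show "pairwise (\<lambda>\<phi> \<psi>. \<phi> \<bullet>c \<psi> = 0) S"
    proof (rule pairwiseI)
      fix \<phi> \<psi> assume "\<phi> \<in> S" "\<psi> \<in> S" "\<phi> \<noteq> \<psi>"
      moreover from this obtain v w where "v \<in> V" "w \<in> V" "\<phi> = lattice_ghz v" "\<psi> = lattice_ghz w"
        by (auto simp: S_def)
      ultimately show "\<phi> \<bullet>c \<psi> = 0" using inner[of v w] by auto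
    qed
  qed
  ultimately have "genuinely_nonlocal d d d S"
    by (simp add: genuinely_nonlocal_def cycle)
  moreover have "S \<subseteq> lattice_ghz_states t"
    using V by (auto simp: S_def lattice_ghz_states_def)
  ultimately show ?thesis
    using card_S by blast
qed

end
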